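(* Let $A$ be a densely defined and closed operator on a complex Hilbert space $\mathcal{H}$. Then there is a one-to-one correspondence between all closed extensions of $A$ and all linear subspaces $\mathfrak{M}\subset\mathcal{D}(A^* )$ that are closed with respect to the graph norm $\|\cdot\|_{\Gamma(A^* )}$ and that satisfy $$\ker (A^* )\cap \overline{\mathfrak{M}}^{\|\cdot\|_{\Gamma(A^* )}}=\{0\}\quad\text{and}\quad\{A^*\phi:\phi\in\overline{\mathfrak{M}}^{\|\cdot\|_{\Gamma(A^* )}}\}\cap\mathcal{D}(A)=\{0\}.$$ The correspondence is $\mathfrak{M}\mapsto A_\mathfrak{M}$, i.e. these closed extensions of $A$ are given by the operators $A_\mathfrak{M}$ with $$\mathcal{D}(A_\mathfrak{M})=\mathcal{D}(A)\dot{+}\{A^*\phi: \phi\in\mathfrak{M}\},\qquad A_\mathfrak{M}(f+A^*\phi)=Af-\phi\quad (f\in\mathcal{D}(A),\ \phi\in\mathfrak{M}).$$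
   Context: All operators are linear operators in $\mathcal{H}$, and extensions of $A$ are understood to be operators in $\mathcal{H}$ (including $A$ itself). $\mathcal{D}(\cdot)$ denotes the domain and $A^*$ the adjoint. The graph norm of $A^*$ is $\|\phi\|_{\Gamma(A^* )}^2=\|\phi\|^2+\|A^*\phi\|^2$ for $\phi\in\mathcal{D}(A^* )$. For a subspace $\mathfrak{M}\subset\mathcal{D}(A^* )$, $\overline{\mathfrak{M}}^{\|\cdot\|_{\Gamma(A^* )}}$ denotes its closure in $\mathcal{D}(A^* )$ with respect to this norm. The symbol $\dot{+}$ denotes the direct (not necessarily orthogonal) sum of linear subspaces. *)

theory Defs
  imports "HOL-Analysis.Analysis"
begin

section \<open>Complex Hilbert spaces\<close>

text \<open>
  A complex Hilbert space is a real Hilbert space (\<^class>\<open>real_inner\<close> and \<^class>\<open>complete_space\<close>)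
  carrying a compatible complex structure. The underlying real inner product is the real part of
  the complex one, so that norm, distance and topology are the ones induced by \<open>cinner\<close>
  (see \<open>norm_eq_sqrt_cinner\<close> and \<open>cinner_self\<close> below). The inner product is conjugate-linear in
  the first and linear in the second argument.
\<close>

class complex_hilbert_space = real_inner + complete_space +
  fixes scaleC :: "complex \<Rightarrow> 'a \<Rightarrow> 'a" (infixr "*\<^sub>C" 75)
    and cinner :: "'a \<Rightarrow> 'a \<Rightarrow> complex" (infix "\<bullet>\<^sub>C" 70)
  assumes scaleC_add_right: "a *\<^sub>C (x + y) = a *\<^sub>C x + a *\<^sub>C y"
    and scaleC_add_left: "(a + b) *\<^sub>C x = a *\<^sub>C x + b *\<^sub>C x"
    and scaleC_scaleC: "a *\<^sub>C (b *\<^sub>C x) = (a * b) *\<^sub>C x"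
    and scaleC_of_real: "complex_of_real r *\<^sub>C x = r *\<^sub>R x"
    and cinner_commute: "x \<bullet>\<^sub>C y = cnj (y \<bullet>\<^sub>C x)"
    and cinner_add_right: "x \<bullet>\<^sub>C (y + z) = x \<bullet>\<^sub>C y + x \<bullet>\<^sub>C z"
    and cinner_scaleC_right: "x \<bullet>\<^sub>C (a *\<^sub>C y) = a * (x \<bullet>\<^sub>C y)"
    and inner_eq_Re_cinner: "inner x y = Re (x \<bullet>\<^sub>C y)"

interpretation complex_vector: vector_space "scaleC :: complex \<Rightarrow> 'a \<Rightarrow> 'a::complex_hilbert_space"
proof
  show "1 *\<^sub>C x = x" for x :: 'a
    using scaleC_of_real[of 1 x] by simp
qed (simp_all add: scaleC_add_right scaleC_add_left scaleC_scaleC)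

lemma cinner_self: "x \<bullet>\<^sub>C x = complex_of_real ((norm x)\<^sup>2)"
  for x :: "'a::complex_hilbert_space"
proof (rule complex_eqI)
  show "Im (x \<bullet>\<^sub>C x) = Im (complex_of_real ((norm x)\<^sup>2))"
    using arg_cong[OF cinner_commute[of x x], of Im] by simp
qed (simp add: power2_norm_eq_inner inner_eq_Re_cinner)

lemma norm_eq_sqrt_cinner: "norm x = sqrt (cmod (x \<bullet>\<^sub>C x))"
  for x :: "'a::complex_hilbert_space"
  unfolding cinner_self norm_of_real by simp

instantiation complex :: complex_hilbert_space
begin
definition scaleC_complex :: "complex \<Rightarrow> complex \<Rightarrow> complex"
  where "scaleC_complex a x = a * x"
definition cinner_complex :: "complex \<Rightarrow> complex \<Rightarrow> complex"
  where "cinner_complex x y = cnj x * y"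
instance
  by standard
    (simp_all add: scaleC_complex_def cinner_complex_def algebra_simps scaleR_conv_of_real
      inner_complex_def)
end


section \<open>Unbounded operators\<close>

text \<open>
  An operator is a partial function, \<^term>\<open>dom T\<close> being its domain. Equality of operators
  is therefore equality of domains and of values, and \<open>B\<close> extends \<open>A\<close> iff \<open>A \<subseteq>\<^sub>m B\<close>.
\<close>

abbreviation app :: "('h \<rightharpoonup> 'h) \<Rightarrow> 'h \<Rightarrow> 'h"
  where "app T f \<equiv> the (T f)"

definition linear_operator :: "('h::complex_hilbert_space \<rightharpoonup> 'h) \<Rightarrow> bool" where
  "linear_operator T \<longleftrightarrow>
     complex_vector.subspace (dom T) \<and>
     (\<forall>f\<in>dom T. \<forall>g\<in>dom T. app T (f + g) = app T f + app T g) \<and>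
     (\<forall>c. \<forall>f\<in>dom T. app T (c *\<^sub>C f) = c *\<^sub>C app T f)"

definition densely_defined :: "('h::complex_hilbert_space \<rightharpoonup> 'h) \<Rightarrow> bool" where
  "densely_defined T \<longleftrightarrow> closure (dom T) = UNIV"

definition closed_operator :: "('h::complex_hilbert_space \<rightharpoonup> 'h) \<Rightarrow> bool" where
  "closed_operator T \<longleftrightarrow> closed (Map.graph T)"

definition closed_extensions :: "('h::complex_hilbert_space \<rightharpoonup> 'h) \<Rightarrow> ('h \<rightharpoonup> 'h) set" where
  "closed_extensions A = {B. linear_operator B \<and> closed_operator B \<and> A \<subseteq>\<^sub>m B}"

definition op_kernel :: "('h::complex_hilbert_space \<rightharpoonup> 'h) \<Rightarrow> 'h set" where
  "op_kernel T = {f \<in> dom T. app T f = 0}"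

text \<open>The vector \<open>\<psi>\<close> below is unique if \<open>T\<close> is densely defined.\<close>

definition adj :: "('h::complex_hilbert_space \<rightharpoonup> 'h) \<Rightarrow> ('h \<rightharpoonup> 'h)" where
  "adj T = (\<lambda>\<phi>. if \<exists>\<psi>. \<forall>f\<in>dom T. \<phi> \<bullet>\<^sub>C app T f = \<psi> \<bullet>\<^sub>C f
                then Some (THE \<psi>. \<forall>f\<in>dom T. \<phi> \<bullet>\<^sub>C app T f = \<psi> \<bullet>\<^sub>C f)
                else None)"


section \<open>The graph norm\<close>

definition graph_norm :: "('h::complex_hilbert_space \<rightharpoonup> 'h) \<Rightarrow> 'h \<Rightarrow> real" where
  "graph_norm T \<phi> = sqrt ((norm \<phi>)\<^sup>2 + (norm (app T \<phi>))\<^sup>2)"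

definition graph_topology :: "('h::complex_hilbert_space \<rightharpoonup> 'h) \<Rightarrow> 'h topology" where
  "graph_topology T = Metric_space.mtopology (dom T) (\<lambda>\<phi> \<psi>. graph_norm T (\<phi> - \<psi>))"

lemma linear_operator_diff:
  assumes T: "linear_operator T" and "f \<in> dom T" "g \<in> dom T"
  shows "f - g \<in> dom T" "app T (f - g) = app T f - app T g"
proof -
  have *: "f - g = f + (-1) *\<^sub>C g" "app T f - app T g = app T f + (-1) *\<^sub>C app T g"
    by simp_all
  have "(-1) *\<^sub>C g \<in> dom T" "app T ((-1) *\<^sub>C g) = (-1) *\<^sub>C app T g"
    using assms unfolding linear_operator_def complex_vector.subspace_def by blast+
  then show "f - g \<in> dom T" "app T (f - g) = app T f - app T g"
    using assms unfolding * linear_operator_def complex_vector.subspace_def by metis+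
qed

lemma Metric_space_graph_norm:
  assumes T: "linear_operator T"
  shows "Metric_space (dom T) (\<lambda>\<phi> \<psi>. graph_norm T (\<phi> - \<psi>))"
proof
  have norm: "graph_norm T (f - g) = norm ((f, app T f) - (g, app T g))"
    if "f \<in> dom T" "g \<in> dom T" for f g
    using linear_operator_diff[OF T that] by (simp add: graph_norm_def norm_Pair)
  show "0 \<le> graph_norm T (f - g)" for f g
    by (simp add: graph_norm_def)
  show "graph_norm T (f - g) = graph_norm T (g - f)" for f g
  proof -
    have 0: "0 \<in> dom T" "app T 0 = 0"
      using T linear_operator_diff[OF T, of 0 0]
      by (auto simp: linear_operator_def complex_vector.subspace_def)
    show ?thesis
    proof (cases "f - g \<in> dom T")
      case True
      then show ?thesis
        using linear_operator_diff[OF T 0(1) True] 0 by (simp add: graph_norm_def norm_minus_commute)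
    next
      case False
      then have "g - f \<notin> dom T"
        using linear_operator_diff(1)[OF T 0(1), of "g - f"] by auto
      with False have "T (f - g) = T (g - f)"
        by (metis domIff)
      then show ?thesis
        by (simp add: graph_norm_def norm_minus_commute)
    qed
  qed
  show "graph_norm T (f - g) = 0 \<longleftrightarrow> f = g" if "f \<in> dom T" "g \<in> dom T" for f g
    using that by (auto simp: norm zero_prod_def)
  show "graph_norm T (f - h) \<le> graph_norm T (f - g) + graph_norm T (g - h)"
    if "f \<in> dom T" "g \<in> dom T" "h \<in> dom T" for f g h
    using norm_triangle_ineq[of "(f, app T f) - (g, app T g)" "(g, app T g) - (h, app T h)"] that
    by (simp add: norm)
qed


section \<open>The extensions \<open>A\<^sub>M\<close>\<close>

definition is_direct_sum :: "'h::complex_hilbert_space set \<Rightarrow> 'h set \<Rightarrow> 'h set \<Rightarrow> bool" where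
  "is_direct_sum W U V \<longleftrightarrow>
     complex_vector.subspace U \<and> complex_vector.subspace V \<and>
     U \<inter> V = {0} \<and> W = {u + v |u v. u \<in> U \<and> v \<in> V}"

definition admissible :: "('h::complex_hilbert_space \<rightharpoonup> 'h) \<Rightarrow> 'h set \<Rightarrow> bool" where
  "admissible A M \<longleftrightarrow>
     complex_vector.subspace M \<and> M \<subseteq> dom (adj A) \<and>
     closedin (graph_topology (adj A)) M \<and>
     op_kernel (adj A) \<inter> (graph_topology (adj A) closure_of M) = {0} \<and>
     {app (adj A) \<phi> |\<phi>. \<phi> \<in> graph_topology (adj A) closure_of M} \<inter> dom A = {0}"

text \<open>
  For admissible \<open>M\<close> the value \<open>A f - \<phi>\<close> does not depend on the representation
  \<open>h = f + A\<^sup>* \<phi>\<close>; for other \<open>M\<close> the definition need not be meaningful.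
\<close>

definition ext_op :: "('h::complex_hilbert_space \<rightharpoonup> 'h) \<Rightarrow> 'h set \<Rightarrow> ('h \<rightharpoonup> 'h)" where
  "ext_op A M = (\<lambda>h.
     if \<exists>f\<in>dom A. \<exists>\<phi>\<in>M. h = f + app (adj A) \<phi>
     then Some (THE g. \<exists>f\<in>dom A. \<exists>\<phi>\<in>M. h = f + app (adj A) \<phi> \<and> g = app A f - \<phi>)
     else None)"

end

theory Submission
  imports Defs
begin

text \<open>
  In \<open>\<H> \<times> \<H>\<close> the orthogonal complement of the graph \<open>\<Gamma>(A)\<close> is \<open>{(A\<^sup>* \<phi>, -\<phi>) | \<phi> \<in> D(A\<^sup>*)}\<close>, and
  \<open>\<phi> \<mapsto> (A\<^sup>* \<phi>, -\<phi>)\<close> is isometric for the graph norm. Hence closed subspaces between \<open>\<Gamma>(A)\<close> and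
  \<open>\<H> \<times> \<H>\<close> are the sums \<open>\<Gamma>(A) \<oplus> {(A\<^sup>* \<phi>, -\<phi>) | \<phi> \<in> M}\<close> with \<open>M\<close> closed in the graph norm, and the two
  conditions on \<open>M\<close> say exactly that such a sum is the graph of an operator.
\<close>

section \<open>Orthogonal projection in real Hilbert spaces\<close>

text \<open>A minimizing sequence for the distance from \<open>x\<close> to \<open>S\<close> is
  Cauchy, and the first variation of the squared distance vanishes at its limit. The real setting
  lets the lemma apply to pairs with the real inner product of
  \<open>'h \<times> 'h\<close>.\<close>

lemma closed_subspace_orthogonal_projection:
  fixes S :: "'a::{real_inner,complete_space} set"
  assumes S: "subspace S" and "closed S"
  obtains s where "s \<in> S" "\<And>v. v \<in> S \<Longrightarrow> inner (x - s) v = 0"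
proof -
  define F where "F s = (norm (x - s))\<^sup>2" for s
  define d where "d = Inf (F ` S)"
  have ne: "F ` S \<noteq> {}"
    using subspace_0[OF S] by auto
  have bdd: "bdd_below (F ` S)"
    by (rule bdd_belowI[of _ 0]) (auto simp: F_def)
  have d_le: "d \<le> F s" if "s \<in> S" for s
    unfolding d_def using that bdd by (simp add: cINF_lower)
  have "\<exists>s\<in>S. F s < d + inverse (real (Suc n))" for n
    using cInf_lessD[OF ne, of "d + inverse (real (Suc n))"] by (auto simp: d_def)
  then obtain s where sS: "\<And>n. s n \<in> S" and sF: "\<And>n. F (s n) < d + inverse (real (Suc n))"
    by metis
  \<comment> \<open>Parallelogram law for \<open>x - u\<close> and \<open>x - v\<close>: the
    midpoint of \<open>u\<close> and \<open>v\<close> stays in \<open>S\<close>, so its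
    \<open>F\<close>-value is at least \<open>d\<close>.\<close>
  have dist_le: "(norm (u - v))\<^sup>2 \<le> 2 * (F u - d) + 2 * (F v - d)" if "u \<in> S" "v \<in> S" for u v
  proof -
    have "(1/2) *\<^sub>R (u + v) \<in> S"
      using S that by (simp add: subspace_add subspace_scale)
    then have "d \<le> F ((1/2) *\<^sub>R (u + v))"
      by (rule d_le)
    moreover have "(norm (u - v))\<^sup>2 = 2 * F u + 2 * F v - 4 * F ((1/2) *\<^sub>R (u + v))"
      unfolding F_def power2_norm_eq_inner
      by (simp add: inner_diff_left inner_diff_right inner_add_left inner_add_right
          inner_commute algebra_simps)
    ultimately show ?thesis by simp
  qed
  have "Cauchy s"
  proof (rule metric_CauchyI)
    fix e :: real assume "e > 0"
    \<comment> \<open>With \<open>e\<^sup>2 / 4\<close>, the two terms \<open>2 * (F _ - d)\<close>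
      in \<open>dist_le\<close> add up to less than \<open>e\<^sup>2\<close>.\<close>
    then obtain N where N: "inverse (real (Suc N)) < e\<^sup>2 / 4"
      using reals_Archimedean[of "e\<^sup>2 / 4"] by auto
    have small: "F (s n) - d < e\<^sup>2 / 4" if "n \<ge> N" for n
    proof -
      have "inverse (real (Suc n)) \<le> inverse (real (Suc N))"
        using that by (intro le_imp_inverse_le) auto
      with sF[of n] N show ?thesis by linarith
    qed
    have "dist (s m) (s n) < e" if "m \<ge> N" "n \<ge> N" for m n
    proof -
      have "(norm (s m - s n))\<^sup>2 < e\<^sup>2"
        using dist_le[OF sS[of m] sS[of n]] small[OF that(1)] small[OF that(2)] by simp
      then show ?thesis
        using \<open>e > 0\<close> by (simp add: dist_norm power_less_imp_less_base)
    qed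
    then show "\<exists>M. \<forall>m\<ge>M. \<forall>n\<ge>M. dist (s m) (s n) < e" by blast
  qed
  then obtain l where l: "s \<longlonglongrightarrow> l"
    using Cauchy_convergent convergent_def by blast
  have lS: "l \<in> S"
    using closed_sequentially[OF \<open>closed S\<close> sS l] .
  have "(\<lambda>n. F (s n)) \<longlonglongrightarrow> F l"
    unfolding F_def by (intro tendsto_intros l)
  moreover have "(\<lambda>n. d + inverse (real (Suc n))) \<longlonglongrightarrow> d + 0"
    by (intro tendsto_intros LIMSEQ_inverse_real_of_nat)
  ultimately have Fl: "F l \<le> d"
    using sF by (auto intro: LIMSEQ_le less_imp_le)
  have "inner (x - l) v = 0" if v: "v \<in> S" for v
  proof (cases "v = 0")
    case False
    \<comment> \<open>This \<open>t\<close> minimizes the quadratic polynomial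
      \<open>F (l + t *\<^sub>R v)\<close>.\<close>
    define t where "t = inner (x - l) v / inner v v"
    have vv: "inner v v > 0"
      using False by simp
    have "l + t *\<^sub>R v \<in> S"
      using S lS v by (simp add: subspace_add subspace_scale)
    then have "F l \<le> F (l + t *\<^sub>R v)"
      using d_le Fl by fastforce
    also have "F (l + t *\<^sub>R v) = F l - 2 * t * inner (x - l) v + t * t * inner v v"
      unfolding F_def power2_norm_eq_inner
      by (simp add: inner_diff_left inner_diff_right inner_add_left inner_add_right
          inner_commute algebra_simps)
    also have "\<dots> = F l - (inner (x - l) v)\<^sup>2 / inner v v"
      using vv by (simp add: t_def field_simps power2_eq_square)
    finally have "(inner (x - l) v)\<^sup>2 / inner v v \<le> 0" by simp
    then show ?thesis
      using vv by (simp add: divide_le_0_iff)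
  qed simp
  with lS show thesis by (rule that)
qed

text \<open>By Pythagoras the \<open>V\<close>-components of a convergent sequence of sums are
  Cauchy. They converge in \<open>V\<close>, so the \<open>W\<close>-components converge as
  well.\<close>

lemma closed_orthogonal_sum:
  fixes V W :: "'a::{real_inner,complete_space} set"
  assumes V: "subspace V" "closed V" and W: "subspace W" "closed W"
    and orth: "\<And>v w. v \<in> V \<Longrightarrow> w \<in> W \<Longrightarrow> inner v w = 0"
  shows "closed {v + w |v w. v \<in> V \<and> w \<in> W}"
  unfolding closed_sequential_limits
proof safe
  fix x l assume "\<forall>n. x n \<in> {v + w |v w. v \<in> V \<and> w \<in> W}" and lim: "x \<longlonglongrightarrow> l"
  then obtain v w where v: "\<And>n. v n \<in> V" and w: "\<And>n. w n \<in> W" and x: "\<And>n. x n = v n + w n"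
    by simp metis
  have le: "dist (v m) (v n) \<le> dist (x m) (x n)" for m n
  proof -
    have "inner (v m - v n) (w m - w n) = 0"
      using v w V W by (intro orth subspace_diff) auto
    then have "(norm (x m - x n))\<^sup>2 = (norm (v m - v n))\<^sup>2 + (norm (w m - w n))\<^sup>2"
      using norm_add_Pythagorean[of "v m - v n" "w m - w n"]
      by (simp add: orthogonal_def x algebra_simps)
    then have "(norm (v m - v n))\<^sup>2 \<le> (norm (x m - x n))\<^sup>2"
      by simp
    then show ?thesis
      unfolding dist_norm by (rule power2_le_imp_le) simp
  qed
  have "Cauchy x"
    using lim by (rule LIMSEQ_imp_Cauchy)
  then have "Cauchy v"
    unfolding Cauchy_def using le by (meson order_le_less_trans)
  then obtain a where a: "v \<longlonglongrightarrow> a"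
    using Cauchy_convergent convergent_def by blast
  have "(\<lambda>n. x n - v n) \<longlonglongrightarrow> l - a"
    by (intro tendsto_diff lim a)
  then have "w \<longlonglongrightarrow> l - a"
    by (simp add: x)
  then have "l - a \<in> W"
    using W(2) w closed_sequentially by blast
  moreover have "a \<in> V"
    using V(2) v a closed_sequentially by blast
  ultimately show "\<exists>v w. l = v + w \<and> v \<in> V \<and> w \<in> W"
    by (intro exI[of _ a] exI[of _ "l - a"]) auto
qed

section \<open>Linear operators and adjoints\<close>

lemma cinner_add_left: "(x + y) \<bullet>\<^sub>C z = x \<bullet>\<^sub>C z + y \<bullet>\<^sub>C z"
  for x :: "'a::complex_hilbert_space"
  by (metis cinner_add_right cinner_commute complex_cnj_add)

lemma cinner_scaleC_left: "(a *\<^sub>C x) \<bullet>\<^sub>C y = cnj a * (x \<bullet>\<^sub>C y)"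
  for x :: "'a::complex_hilbert_space"
  by (metis cinner_commute cinner_scaleC_right complex_cnj_mult)

lemma cinner_minus_left: "(- x) \<bullet>\<^sub>C y = - (x \<bullet>\<^sub>C y)"
  for x :: "'a::complex_hilbert_space"
  using cinner_scaleC_left[of "-1" x y] by simp

lemma cinner_zero_left: "0 \<bullet>\<^sub>C y = 0"
  for y :: "'a::complex_hilbert_space"
  using cinner_add_left[of 0 0 y] by simp

text \<open>An equation \<open>T x = Some a\<close> carries domain membership and value at once;
  later proofs manipulate such equations instead of \<open>dom\<close> and \<open>app\<close>
  separately.\<close>

lemma linear_operator_iff:
  "linear_operator T \<longleftrightarrow> T 0 = Some 0 \<and>
    (\<forall>x a y b. T x = Some a \<longrightarrow> T y = Some b \<longrightarrow> T (x + y) = Some (a + b)) \<and>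
    (\<forall>c x a. T x = Some a \<longrightarrow> T (c *\<^sub>C x) = Some (c *\<^sub>C a))" (is "?L \<longleftrightarrow> ?R")
proof
  assume L: ?L
  then have dom0: "0 \<in> dom T"
    and add: "\<And>x y. x \<in> dom T \<Longrightarrow> y \<in> dom T \<Longrightarrow> x + y \<in> dom T \<and> app T (x + y) = app T x + app T y"
    and scale: "\<And>c x. x \<in> dom T \<Longrightarrow> c *\<^sub>C x \<in> dom T \<and> app T (c *\<^sub>C x) = c *\<^sub>C app T x"
    by (auto simp: linear_operator_def complex_vector.subspace_def)
  have "T 0 = Some 0"
    using scale[OF dom0, of 0] by auto
  moreover have "T (x + y) = Some (a + b)" if "T x = Some a" "T y = Some b" for x a y b
    using add[of x y] that by (auto simp: dom_def)
  moreover have "T (c *\<^sub>C x) = Some (c *\<^sub>C a)" if "T x = Some a" for c x a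
    using scale[of x c] that by (auto simp: dom_def)
  ultimately show ?R by blast
next
  assume ?R
  then show ?L
    by (fastforce simp: linear_operator_def complex_vector.subspace_def dom_def)
qed

lemma linear_operatorD:
  assumes "linear_operator T"
  shows "T 0 = Some 0"
    and "T x = Some a \<Longrightarrow> T y = Some b \<Longrightarrow> T (x + y) = Some (a + b)"
    and "T x = Some a \<Longrightarrow> T (c *\<^sub>C x) = Some (c *\<^sub>C a)"
    and "T x = Some a \<Longrightarrow> T (- x) = Some (- a)"
    and "T x = Some a \<Longrightarrow> T y = Some b \<Longrightarrow> T (x - y) = Some (a - b)"
proof -
  show *: "T 0 = Some 0"
    "T x = Some a \<Longrightarrow> T y = Some b \<Longrightarrow> T (x + y) = Some (a + b)"
    "T x = Some a \<Longrightarrow> T (c *\<^sub>C x) = Some (c *\<^sub>C a)" for x y a b c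
    using assms unfolding linear_operator_iff by blast+
  show neg: "T x = Some a \<Longrightarrow> T (- x) = Some (- a)" for x a
    using *(3)[of x a "-1"] by simp
  show "T x = Some a \<Longrightarrow> T y = Some b \<Longrightarrow> T (x - y) = Some (a - b)"
    using *(2)[OF _ neg, of x a y b] by simp
qed

lemma subspace_graph:
  assumes "linear_operator T"
  shows "subspace (Map.graph T)"
  unfolding subspace_def
  using linear_operatorD(1,2)[OF assms] linear_operatorD(3)[OF assms, of _ _ "complex_of_real _"]
  by (auto simp: Map.graph_def zero_prod_def scaleC_of_real)

text \<open>Density makes the representing vector unique, so the definite description in
  \<open>adj\<close> can be replaced by its defining relation.\<close>

lemma adj_eq_Some_iff:
  assumes "densely_defined T"
  shows "adj T \<phi> = Some \<psi> \<longleftrightarrow> (\<forall>f\<in>dom T. \<phi> \<bullet>\<^sub>C app T f = \<psi> \<bullet>\<^sub>C f)"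
proof -
  have uniq: "\<psi> = \<psi>'"
    if *: "\<forall>f\<in>dom T. \<phi> \<bullet>\<^sub>C app T f = \<psi> \<bullet>\<^sub>C f" "\<forall>f\<in>dom T. \<phi> \<bullet>\<^sub>C app T f = \<psi>' \<bullet>\<^sub>C f" for \<psi> \<psi>'
  proof -
    have "inner \<psi> f = inner \<psi>' f" if "f \<in> dom T" for f
      using \<open>f \<in> dom T\<close> * by (simp add: inner_eq_Re_cinner)
    \<comment> \<open>The vectors orthogonal to \<open>\<psi> - \<psi>'\<close> form a closed set;
      containing a dense set, it contains \<open>\<psi> - \<psi>'\<close> itself.\<close>
    then have "dom T \<subseteq> {f. inner (\<psi> - \<psi>') f = 0}"
      by (auto simp: inner_diff_left)
    moreover have "closed {f. inner (\<psi> - \<psi>') f = 0}"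
      by (intro closed_Collect_eq continuous_intros)
    ultimately have "closure (dom T) \<subseteq> {f. inner (\<psi> - \<psi>') f = 0}"
      by (rule closure_minimal)
    then have "inner (\<psi> - \<psi>') (\<psi> - \<psi>') = 0"
      using assms unfolding densely_defined_def by blast
    then show ?thesis by simp
  qed
  show ?thesis
  proof (cases "\<exists>\<psi>. \<forall>f\<in>dom T. \<phi> \<bullet>\<^sub>C app T f = \<psi> \<bullet>\<^sub>C f")
    case True
    then obtain \<theta> where \<theta>: "\<forall>f\<in>dom T. \<phi> \<bullet>\<^sub>C app T f = \<theta> \<bullet>\<^sub>C f" by blast
    then have "(THE \<psi>. \<forall>f\<in>dom T. \<phi> \<bullet>\<^sub>C app T f = \<psi> \<bullet>\<^sub>C f) = \<theta>"
      using uniq by (intro the_equality) auto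
    then have "adj T \<phi> = Some \<theta>"
      using True by (simp add: adj_def)
    then show ?thesis
      using \<theta> uniq by auto
  next
    case False
    then show ?thesis by (auto simp: adj_def)
  qed
qed

lemma linear_operator_adj:
  assumes "densely_defined T"
  shows "linear_operator (adj T)"
  unfolding linear_operator_iff adj_eq_Some_iff[OF assms]
  by (auto simp: cinner_zero_left cinner_add_left cinner_scaleC_left)

text \<open>Up to taking real parts, orthogonality of \<open>(x, y)\<close> to
  \<open>(f, T f)\<close> is the defining relation of \<open>adj T\<close> at \<open>- y\<close>.
  Complex linearity of \<open>T\<close> recovers the full complex identity from its real
  part.\<close>

lemma orthogonal_graph_iff:
  assumes T: "linear_operator T" "densely_defined T"
  shows "(\<forall>p\<in>Map.graph T. inner (x, y) p = 0) \<longleftrightarrow> adj T (- y) = Some x"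
proof
  assume *: "\<forall>p\<in>Map.graph T. inner (x, y) p = 0"
  have Re0: "Re (x \<bullet>\<^sub>C f + y \<bullet>\<^sub>C g) = 0" if "T f = Some g" for f g
    using bspec[OF *, of "(f, g)"] that by (simp add: Map.graph_def inner_eq_Re_cinner)
  have "x \<bullet>\<^sub>C f + y \<bullet>\<^sub>C g = 0" if fg: "T f = Some g" for f g
  proof (rule complex_eqI)
    \<comment> \<open>the imaginary part is controlled by testing with \<open>\<i> (f, g)\<close>\<close>
    show "Im (x \<bullet>\<^sub>C f + y \<bullet>\<^sub>C g) = Im 0"
      using Re0[OF linear_operatorD(3)[OF T(1) fg, of \<i>]] by (simp add: cinner_scaleC_right)
  qed (use Re0[OF fg] in simp)
  then show "adj T (- y) = Some x"
    by (auto simp: adj_eq_Some_iff[OF T(2)] cinner_minus_left add_eq_0_iff dom_def)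
next
  assume adj: "adj T (- y) = Some x"
  have "inner (x, y) (f, g) = 0" if "T f = Some g" for f g
  proof -
    have "x \<bullet>\<^sub>C f = - (y \<bullet>\<^sub>C g)"
      using adj that by (force simp: adj_eq_Some_iff[OF T(2)] cinner_minus_left)
    then show ?thesis
      by (simp add: inner_eq_Re_cinner)
  qed
  then show "\<forall>p\<in>Map.graph T. inner (x, y) p = 0"
    by (auto simp only: Map.graph_def)
qed

section \<open>Rotated graphs of restrictions of the adjoint\<close>

text \<open>The image of the graph of \<open>adj A\<close> restricted to \<open>M\<close> under the
  rotation sending \<open>(\<phi>, \<psi>)\<close> to \<open>(\<psi>, - \<phi>)\<close>. For linear,
  densely defined \<open>A\<close> and \<open>M = dom (adj A)\<close> it is the orthogonal
  complement of the graph of \<open>A\<close>.\<close>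

definition rot_graph :: "('h::complex_hilbert_space \<rightharpoonup> 'h) \<Rightarrow> 'h set \<Rightarrow> ('h \<times> 'h) set"
  where "rot_graph A M = {(x, y). adj A (- y) = Some x \<and> - y \<in> M}"

text \<open>The map \<open>?J\<close> is an isometry from the graph norm into the product and
  carries \<open>M\<close> onto \<open>rot_graph A M\<close>, so sequential closedness transfers
  both ways.\<close>

lemma closed_rot_graph_iff:
  assumes A: "linear_operator A" "densely_defined A" and M: "M \<subseteq> dom (adj A)"
  shows "closed (rot_graph A M) \<longleftrightarrow> closedin (graph_topology (adj A)) M"
proof -
  let ?d = "\<lambda>\<phi> \<psi>. graph_norm (adj A) (\<phi> - \<psi>)"
  let ?J = "\<lambda>\<phi>. (app (adj A) \<phi>, - \<phi>)"
  note lin = linear_operator_adj[OF A(2)]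
  interpret Metric_space "dom (adj A)" ?d
    by (rule Metric_space_graph_norm[OF lin])
  have isom: "?d \<phi> \<psi> = dist (?J \<phi>) (?J \<psi>)" if "\<phi> \<in> dom (adj A)" "\<psi> \<in> dom (adj A)" for \<phi> \<psi>
    using linear_operator_diff[OF lin that]
    by (simp add: graph_norm_def dist_norm norm_Pair norm_minus_commute add.commute)
  have lim: "limitin mtopology \<sigma> l sequentially \<longleftrightarrow> (\<lambda>n. ?J (\<sigma> n)) \<longlonglongrightarrow> ?J l"
    if "range \<sigma> \<subseteq> dom (adj A)" "l \<in> dom (adj A)" for \<sigma> l
  proof -
    have "\<sigma> n \<in> dom (adj A)" for n
      using that by auto
    then show ?thesis
      using that(2) by (simp add: limit_metric_sequentially lim_sequentially isom)
  qed
  have top: "graph_topology (adj A) = mtopology"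
    by (simp add: graph_topology_def)
  have J_in: "?J \<phi> \<in> rot_graph A M \<longleftrightarrow> \<phi> \<in> M" if "\<phi> \<in> dom (adj A)" for \<phi>
    using that by (auto simp: rot_graph_def dom_def)
  have J_of: "p \<in> rot_graph A M \<Longrightarrow> p = ?J (- snd p) \<and> - snd p \<in> M" for p
    by (auto simp: rot_graph_def)
  show ?thesis
  proof
    assume cl: "closed (rot_graph A M)"
    have "l \<in> M" if \<sigma>: "range \<sigma> \<subseteq> M" and l: "limitin mtopology \<sigma> l sequentially" for \<sigma> l
    proof -
      have ldom: "l \<in> dom (adj A)"
        using l by (simp add: limit_metric_sequentially)
      have "(\<lambda>n. ?J (\<sigma> n)) \<longlonglongrightarrow> ?J l"
        using lim[of \<sigma> l] \<sigma> M l ldom by blast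
      moreover have "?J (\<sigma> n) \<in> rot_graph A M" for n
        using J_in \<sigma> M by blast
      ultimately have "?J l \<in> rot_graph A M"
        using closed_sequentially[OF cl, of "\<lambda>n. ?J (\<sigma> n)"] by blast
      then show "l \<in> M"
        using J_in[OF ldom] by blast
    qed
    then show "closedin (graph_topology (adj A)) M"
      using M by (auto simp: top metric_closedin_iff_sequentially_closed)
  next
    assume cl: "closedin (graph_topology (adj A)) M"
    show "closed (rot_graph A M)"
      unfolding closed_sequential_limits
    proof safe
      fix p x y assume p: "\<forall>n. p n \<in> rot_graph A M" and lim_p: "p \<longlonglongrightarrow> (x, y)"
      \<comment> \<open>A limit in the product must be shown to have the form \<open>?J l\<close>:
        orthogonality to the graph of \<open>A\<close> passes to limits and characterizes that
        form.\<close>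
      have "inner (x, y) q = 0" if "q \<in> Map.graph A" for q
      proof -
        have "inner (p n) q = 0" for n
          using p that orthogonal_graph_iff[OF A, of "fst (p n)" "snd (p n)"]
          by (auto simp: rot_graph_def split_beta)
        moreover have "(\<lambda>n. inner (p n) q) \<longlonglongrightarrow> inner (x, y) q"
          by (intro tendsto_intros lim_p)
        ultimately show ?thesis
          by (simp add: LIMSEQ_const_iff)
      qed
      then have adj: "adj A (- y) = Some x"
        using orthogonal_graph_iff[OF A] by blast
      define \<sigma> where "\<sigma> n = - snd (p n)" for n
      have \<sigma>: "p n = ?J (\<sigma> n)" "\<sigma> n \<in> M" for n
        using J_of p by (auto simp: \<sigma>_def)
      have "(\<lambda>n. ?J (\<sigma> n)) \<longlonglongrightarrow> ?J (- y)"
        using lim_p adj by (simp flip: \<sigma>(1))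
      then have "limitin mtopology \<sigma> (- y) sequentially"
        using lim[of \<sigma> "- y"] \<sigma>(2) M adj by blast
      then have "- y \<in> M"
        using cl \<sigma>(2) unfolding top metric_closedin_iff_sequentially_closed
        by (metis image_subsetI)
      with adj show "(x, y) \<in> rot_graph A M"
        by (simp add: rot_graph_def)
    qed
  qed
qed

lemma subspace_rot_graph:
  assumes "densely_defined A" "complex_vector.subspace M"
  shows "subspace (rot_graph A M)"
proof -
  note lin = linear_operatorD[OF linear_operator_adj[OF assms(1)]]
  have mem: "p \<in> rot_graph A M \<longleftrightarrow> adj A (- snd p) = Some (fst p) \<and> - snd p \<in> M" for p
    by (simp add: rot_graph_def split_beta)
  show ?thesis
    unfolding subspace_def
  proof (intro conjI ballI allI)
    show "0 \<in> rot_graph A M"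
      using lin(1) complex_vector.subspace_0[OF assms(2)] by (simp add: mem)
  next
    fix p q assume "p \<in> rot_graph A M" "q \<in> rot_graph A M"
    then show "p + q \<in> rot_graph A M"
      using lin(2)[of "- snd p" "fst p" "- snd q" "fst q"]
        complex_vector.subspace_add[OF assms(2), of "- snd p" "- snd q"]
      by (simp add: mem)
  next
    fix c p assume "p \<in> rot_graph A M"
    then show "c *\<^sub>R p \<in> rot_graph A M"
      using lin(3)[of "- snd p" "fst p" "complex_of_real c"]
        complex_vector.subspace_scale[OF assms(2), of "- snd p" "complex_of_real c"]
      by (simp add: mem scaleC_of_real del: complex_vector.scale_minus_right)
  qed
qed

text \<open>Since \<open>M\<close> is closed, the closures drop out. If \<open>adj A\<close> sends
  an element of \<open>M\<close> into \<open>dom A\<close>, the second intersection condition makes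
  the image 0 and the first then makes the element 0. The conjunct \<open>0 \<in> dom A\<close>
  accounts for the intersection being equal to \<open>{0}\<close> rather than merely contained in
  it.\<close>

lemma admissible_iff:
  assumes "densely_defined A"
  shows "admissible A M \<longleftrightarrow>
    complex_vector.subspace M \<and> M \<subseteq> dom (adj A) \<and> closedin (graph_topology (adj A)) M \<and>
    (\<forall>\<phi>\<in>M. app (adj A) \<phi> \<in> dom A \<longrightarrow> \<phi> = 0) \<and> 0 \<in> dom A"
    (is "_ \<longleftrightarrow> ?R")
proof
  assume adm: "admissible A M"
  then have cl: "closedin (graph_topology (adj A)) M"
    by (simp add: admissible_def)
  note * = adm[unfolded admissible_def closure_of_closedin[OF cl]]
  have "\<phi> = 0" if "\<phi> \<in> M" "app (adj A) \<phi> \<in> dom A" for \<phi>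
  proof -
    have "app (adj A) \<phi> \<in> {app (adj A) \<phi> |\<phi>. \<phi> \<in> M} \<inter> dom A"
      using that by blast
    then have "app (adj A) \<phi> = 0"
      using * by blast
    then have "\<phi> \<in> op_kernel (adj A) \<inter> M"
      using * that by (auto simp: op_kernel_def)
    then show ?thesis
      using * by blast
  qed
  moreover have "0 \<in> dom A"
    using * by blast
  moreover have "complex_vector.subspace M" "M \<subseteq> dom (adj A)"
    using adm by (simp_all add: admissible_def)
  ultimately show ?R
    using cl by blast
next
  assume R: ?R
  then have cl: "closedin (graph_topology (adj A)) M"
    by blast
  have 0: "adj A 0 = Some 0"
    using linear_operatorD(1)[OF linear_operator_adj[OF assms]] .
  have "0 \<in> M"
    using R complex_vector.subspace_0 by blast
  \<comment> \<open>A kernel vector is sent to 0, an element of \<open>dom A\<close>, so the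
    implication in \<open>?R\<close> applies to it.\<close>
  have "op_kernel (adj A) \<inter> M = {0}"
    using R 0 \<open>0 \<in> M\<close> by (auto simp: op_kernel_def)
  moreover have "{app (adj A) \<phi> |\<phi>. \<phi> \<in> M} \<inter> dom A = {0}"
  proof (intro equalityI subsetI)
    fix z assume "z \<in> {app (adj A) \<phi> |\<phi>. \<phi> \<in> M} \<inter> dom A"
    then obtain \<phi> where \<phi>: "z = app (adj A) \<phi>" "\<phi> \<in> M" "z \<in> dom A" by blast
    then have "\<phi> = 0"
      using R by blast
    with \<phi>(1) 0 show "z \<in> {0}" by simp
  next
    fix z :: 'a assume "z \<in> {0}"
    moreover have "0 = app (adj A) 0" by (simp add: 0)
    ultimately show "z \<in> {app (adj A) \<phi> |\<phi>. \<phi> \<in> M} \<inter> dom A"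
      using R \<open>0 \<in> M\<close> by auto
  qed
  ultimately show "admissible A M"
    using R by (simp add: admissible_def closure_of_closedin[OF cl])
qed

section \<open>The correspondence\<close>

text \<open>The inverse of the correspondence: those \<open>\<phi>\<close> whose rotated pair lies
  in the graph of \<open>B\<close>. For linear, densely defined \<open>A\<close> these pairs are the
  part of the graph of \<open>B\<close> orthogonal to the graph of \<open>A\<close>.\<close>

definition ext_space :: "('h::complex_hilbert_space \<rightharpoonup> 'h) \<Rightarrow> ('h \<rightharpoonup> 'h) \<Rightarrow> 'h set"
  where "ext_space A B = {\<phi>. \<exists>\<psi>. adj A \<phi> = Some \<psi> \<and> B \<psi> = Some (- \<phi>)}"

context
  fixes A :: "'h::complex_hilbert_space \<rightharpoonup> 'h"
  assumes lin: "linear_operator A" and dense: "densely_defined A" and closed: "closed_operator A"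
begin

lemmas linA = linear_operatorD[OF lin]
lemmas linadj = linear_operatorD[OF linear_operator_adj[OF dense]]

text \<open>The pair \<open>(f, - \<phi>)\<close> lies in the graph of \<open>A\<close> and is
  orthogonal to it, hence to itself.\<close>

lemma adj_eq_uminus:
  assumes "adj A \<phi> = Some f" "A f = Some (- \<phi>)"
  shows "\<phi> = 0"
proof -
  have "inner (f, - \<phi>) (f, - \<phi>) = 0"
    using orthogonal_graph_iff[OF lin dense, of f "- \<phi>"] assms by (auto simp: Map.graph_def)
  then show ?thesis by (simp add: zero_prod_def del: inner_Pair)
qed

section \<open>From admissible subspaces to closed extensions\<close>

context
  fixes M :: "'h set"
  assumes adm: "admissible A M"
begin

lemma admD:
  shows "complex_vector.subspace M" and "M \<subseteq> dom (adj A)"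
    and "closedin (graph_topology (adj A)) M"
    and "\<phi> \<in> M \<Longrightarrow> adj A \<phi> = Some \<psi> \<Longrightarrow> A \<psi> = Some g \<Longrightarrow> \<phi> = 0"
  using adm by (auto simp: admissible_iff[OF dense] dom_def)

text \<open>Well-definedness: two representations of one vector give
  \<open>adj A (\<phi> - \<phi>') = Some (f' - f)\<close> with \<open>f' - f\<close> in
  \<open>dom A\<close>, so admissibility forces them to coincide.\<close>

lemma ext_op_eq:
  assumes "A f = Some a" "\<phi> \<in> M" "adj A \<phi> = Some \<psi>"
  shows "ext_op A M (f + \<psi>) = Some (a - \<phi>)"
proof -
  have "g = a - \<phi>"
    if g: "f' \<in> dom A" "\<phi>' \<in> M" "f + \<psi> = f' + app (adj A) \<phi>'" "g = app A f' - \<phi>'" for g f' \<phi>'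
  proof -
    obtain a' where a': "A f' = Some a'"
      using g(1) by blast
    obtain \<psi>' where \<psi>': "adj A \<phi>' = Some \<psi>'"
      using g(2) admD(2) by blast
    have eq: "\<psi> - \<psi>' = f' - f"
      using g(3) \<psi>' by (simp add: algebra_simps)
    have "\<phi> - \<phi>' = 0"
    proof (rule admD(4))
      show "\<phi> - \<phi>' \<in> M"
        using admD(1) assms(2) g(2) by (rule complex_vector.subspace_diff)
      show "adj A (\<phi> - \<phi>') = Some (f' - f)"
        using linadj(5)[OF assms(3) \<psi>'] by (simp add: eq)
      show "A (f' - f) = Some (a' - a)"
        using linA(5)[OF a' assms(1)] .
    qed
    moreover from this have "f' = f"
      using assms(3) \<psi>' eq by simp
    ultimately show ?thesis
      using g(4) assms(1) by simp
  qed
  moreover have "f \<in> dom A" "f + \<psi> = f + app (adj A) \<phi>" "a - \<phi> = app A f - \<phi>"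
    using assms by auto
  ultimately have "(THE g. \<exists>f'\<in>dom A. \<exists>\<phi>'\<in>M. f + \<psi> = f' + app (adj A) \<phi>' \<and> g = app A f' - \<phi>') = a - \<phi>"
    using assms(2) by (intro the_equality) blast+
  moreover have "\<exists>f'\<in>dom A. \<exists>\<phi>'\<in>M. f + \<psi> = f' + app (adj A) \<phi>'"
    using assms by force
  ultimately show ?thesis
    by (simp add: ext_op_def)
qed

lemma ext_op_eq_Some_iff:
  "ext_op A M h = Some g \<longleftrightarrow>
    (\<exists>f a \<phi> \<psi>. A f = Some a \<and> \<phi> \<in> M \<and> adj A \<phi> = Some \<psi> \<and> h = f + \<psi> \<and> g = a - \<phi>)"
  (is "?L \<longleftrightarrow> ?R")
proof
  assume ?L
  then have "\<exists>f\<in>dom A. \<exists>\<phi>\<in>M. h = f + app (adj A) \<phi>"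
    by (auto simp: ext_op_def split: if_splits)
  then obtain f \<phi> where "f \<in> dom A" and \<phi>: "\<phi> \<in> M" and h: "h = f + app (adj A) \<phi>" by blast
  moreover obtain a \<psi> where *: "A f = Some a" "adj A \<phi> = Some \<psi>"
    using calculation admD(2) by blast
  ultimately have "g = a - \<phi>"
    using ext_op_eq[OF *(1) \<phi> *(2)] \<open>?L\<close> by simp
  with * \<phi> h show ?R by fastforce
qed (use ext_op_eq in blast)

text \<open>Turns closedness of the operator into closedness of a sum of two mutually orthogonal
  subspaces.\<close>

lemma graph_ext_op:
  "Map.graph (ext_op A M) = {v + w |v w. v \<in> Map.graph A \<and> w \<in> rot_graph A M}"
proof (intro set_eqI iffI)
  fix p assume "p \<in> Map.graph (ext_op A M)"
  then obtain f a \<phi> \<psi> where *: "A f = Some a" "\<phi> \<in> M" "adj A \<phi> = Some \<psi>" "p = (f, a) + (\<psi>, - \<phi>)"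
    by (auto simp: Map.graph_def ext_op_eq_Some_iff)
  then have "(f, a) \<in> Map.graph A" "(\<psi>, - \<phi>) \<in> rot_graph A M"
    by (auto simp: Map.graph_def rot_graph_def)
  with *(4) show "p \<in> {v + w |v w. v \<in> Map.graph A \<and> w \<in> rot_graph A M}" by blast
next
  fix p assume "p \<in> {v + w |v w. v \<in> Map.graph A \<and> w \<in> rot_graph A M}"
  \<comment> \<open>Here \<open>\<phi>\<close> is the second coordinate of the rotated pair, so the
    element of \<open>M\<close> is \<open>- \<phi>\<close>.\<close>
  then obtain f a \<psi> \<phi> where "A f = Some a" "adj A (- \<phi>) = Some \<psi>" "- \<phi> \<in> M" "p = (f + \<psi>, a + \<phi>)"
    by (auto simp: Map.graph_def rot_graph_def)
  then show "p \<in> Map.graph (ext_op A M)"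
    using ext_op_eq[of f a "- \<phi>" \<psi>] by (auto simp: Map.graph_def)
qed

lemma ext_op_in_closed_extensions: "ext_op A M \<in> closed_extensions A"
proof -
  have "linear_operator (ext_op A M)"
    unfolding linear_operator_iff
  proof (intro conjI allI impI)
    show "ext_op A M 0 = Some 0"
      using ext_op_eq[OF linA(1) complex_vector.subspace_0[OF admD(1)] linadj(1)] by simp
  next
    fix x a y b assume "ext_op A M x = Some a" "ext_op A M y = Some b"
    then obtain f1 a1 \<phi>1 \<psi>1 f2 a2 \<phi>2 \<psi>2
      where 1: "A f1 = Some a1" "\<phi>1 \<in> M" "adj A \<phi>1 = Some \<psi>1" "x = f1 + \<psi>1" "a = a1 - \<phi>1"
        and 2: "A f2 = Some a2" "\<phi>2 \<in> M" "adj A \<phi>2 = Some \<psi>2" "y = f2 + \<psi>2" "b = a2 - \<phi>2"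
      unfolding ext_op_eq_Some_iff by blast
    show "ext_op A M (x + y) = Some (a + b)"
      using ext_op_eq[OF linA(2)[OF 1(1) 2(1)] complex_vector.subspace_add[OF admD(1) 1(2) 2(2)]
          linadj(2)[OF 1(3) 2(3)]]
      by (simp add: 1 2 algebra_simps)
  next
    fix c x a assume "ext_op A M x = Some a"
    then obtain f a' \<phi> \<psi>
      where 1: "A f = Some a'" "\<phi> \<in> M" "adj A \<phi> = Some \<psi>" "x = f + \<psi>" "a = a' - \<phi>"
      unfolding ext_op_eq_Some_iff by blast
    show "ext_op A M (c *\<^sub>C x) = Some (c *\<^sub>C a)"
      using ext_op_eq[OF linA(3)[OF 1(1)] complex_vector.subspace_scale[OF admD(1) 1(2)]
          linadj(3)[OF 1(3)], of c c]
      by (simp add: 1 complex_vector.scale_right_distrib complex_vector.scale_right_diff_distrib)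
  qed
  moreover have "closed_operator (ext_op A M)"
    unfolding closed_operator_def graph_ext_op
  proof (rule closed_orthogonal_sum)
    show "closed (rot_graph A M)"
      using closed_rot_graph_iff[OF lin dense admD(2)] admD(3) by blast
    show "inner v w = 0" if "v \<in> Map.graph A" "w \<in> rot_graph A M" for v w
      using that orthogonal_graph_iff[OF lin dense, of "fst w" "snd w"]
      by (auto simp: rot_graph_def inner_commute split_beta)
  qed (use closed in \<open>auto simp: closed_operator_def subspace_graph lin
        intro: subspace_rot_graph dense admD(1)\<close>)
  \<comment> \<open>Vectors of \<open>dom A\<close> are represented with
    \<open>\<phi> = 0\<close>.\<close>
  moreover have "A \<subseteq>\<^sub>m ext_op A M"
    using ext_op_eq[OF _ complex_vector.subspace_0[OF admD(1)] linadj(1)]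
    by (auto simp: map_le_def dom_def)
  ultimately show ?thesis
    by (simp add: closed_extensions_def)
qed

text \<open>For the inclusion into \<open>M\<close>, subtracting the \<open>M\<close>-component from
  the rotated pair of \<open>\<phi>\<close> leaves a pair in the graph of \<open>A\<close> that is
  again a rotated pair, so it vanishes by \<open>adj_eq_uminus\<close>.\<close>

lemma ext_space_ext_op: "ext_space A (ext_op A M) = M"
proof (intro equalityI subsetI)
  fix \<phi> assume "\<phi> \<in> M"
  moreover obtain \<psi> where "adj A \<phi> = Some \<psi>"
    using calculation admD(2) by blast
  ultimately show "\<phi> \<in> ext_space A (ext_op A M)"
    using ext_op_eq[OF linA(1), of \<phi> \<psi>] by (auto simp: ext_space_def)
next
  fix \<phi> assume "\<phi> \<in> ext_space A (ext_op A M)"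
  then obtain \<psi> f a \<phi>' \<psi>' where *: "adj A \<phi> = Some \<psi>" "A f = Some a" "\<phi>' \<in> M"
      "adj A \<phi>' = Some \<psi>'" "\<psi> = f + \<psi>'" "- \<phi> = a - \<phi>'"
    by (auto simp: ext_space_def ext_op_eq_Some_iff)
  have "a = - (\<phi> - \<phi>')"
    using *(6) by (simp add: algebra_simps)
  then have "\<phi> - \<phi>' = 0"
    using linadj(5)[OF *(1,4)] * by (intro adj_eq_uminus) auto
  with *(3) show "\<phi> \<in> M" by simp
qed

lemma is_direct_sum_ext_op:
  "is_direct_sum (dom (ext_op A M)) (dom A) {app (adj A) \<phi> |\<phi>. \<phi> \<in> M}"
  unfolding is_direct_sum_def
proof (intro conjI)
  show "complex_vector.subspace (dom A)"
    using lin by (simp add: linear_operator_def)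
  have adj_lin: "linear_operator (adj A)"
    using dense by (rule linear_operator_adj)
  show "complex_vector.subspace {app (adj A) \<phi> |\<phi>. \<phi> \<in> M}"
    unfolding complex_vector.subspace_def
  proof (safe, goal_cases)
    case 1
    show ?case
      using linadj(1) complex_vector.subspace_0[OF admD(1)] by force
  next
    case (2 _ _ \<phi> \<phi>')
    then have "app (adj A) (\<phi> + \<phi>') = app (adj A) \<phi> + app (adj A) \<phi>'"
      using adj_lin subsetD[OF admD(2)] by (simp add: linear_operator_def)
    with 2 show ?case
      using complex_vector.subspace_add[OF admD(1)] by metis
  next
    case (3 c _ \<phi>)
    then have "app (adj A) (c *\<^sub>C \<phi>) = c *\<^sub>C app (adj A) \<phi>"
      using adj_lin subsetD[OF admD(2)] by (simp add: linear_operator_def)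
    with 3 show ?case
      using complex_vector.subspace_scale[OF admD(1)] by metis
  qed
  \<comment> \<open>This is the second intersection condition of admissibility, as \<open>M\<close>
    is its own closure.\<close>
  show "dom A \<inter> {app (adj A) \<phi> |\<phi>. \<phi> \<in> M} = {0}"
    using adm closure_of_closedin[OF admD(3)] by (simp add: admissible_def Int_commute)
  have "dom (ext_op A M) = {h. \<exists>f\<in>dom A. \<exists>\<phi>\<in>M. h = f + app (adj A) \<phi>}"
    unfolding ext_op_def dom_def by simp
  then show "dom (ext_op A M) = {u + v |u v. u \<in> dom A \<and> v \<in> {app (adj A) \<phi> |\<phi>. \<phi> \<in> M}}"
    by blast
qed

end

section \<open>From closed extensions back to admissible subspaces\<close>

context
  fixes B :: "'h \<rightharpoonup> 'h"
  assumes B: "B \<in> closed_extensions A"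
begin

lemma linB: "linear_operator B"
  using B by (simp add: closed_extensions_def)

lemma extB: "A f = Some a \<Longrightarrow> B f = Some a"
  using B by (force simp: closed_extensions_def map_le_def dom_def)

text \<open>Closedness comes from intersecting the graph of \<open>B\<close> with the orthogonal
  complement of the graph of \<open>A\<close>. The intersection conditions hold because
  \<open>B\<close> agrees with \<open>A\<close> on \<open>dom A\<close>, which reduces them to
  \<open>adj_eq_uminus\<close>.\<close>

lemma admissible_ext_space: "admissible A (ext_space A B)"
proof -
  let ?M = "ext_space A B"
  note linB = linear_operatorD[OF linB]
  have sub: "?M \<subseteq> dom (adj A)"
    by (auto simp: ext_space_def)
  have "complex_vector.subspace ?M"
    unfolding complex_vector.subspace_def ext_space_def
  proof (safe, goal_cases)
    case 1
    show ?case
      using linadj(1) linB(1) by auto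
  next
    case (2 \<phi> \<phi>' \<psi> \<psi>')
    then show ?case
      using linadj(2)[of \<phi> \<psi> \<phi>' \<psi>'] linB(2)[of \<psi> "- \<phi>" \<psi>' "- \<phi>'"] by (simp add: add.commute)
  next
    case (3 c \<phi> \<psi>)
    then show ?case
      using linadj(3)[of \<phi> \<psi> c] linB(3)[of \<psi> "- \<phi>" c] by simp
  qed
  moreover have "closedin (graph_topology (adj A)) ?M"
  proof -
    have "rot_graph A ?M = Map.graph B \<inter> rot_graph A (dom (adj A))"
      by (auto simp: rot_graph_def ext_space_def Map.graph_def)
    \<comment> \<open>The whole domain is trivially closed in its own graph topology.\<close>
    moreover have "closed (rot_graph A (dom (adj A)))"
    proof -
      interpret Metric_space "dom (adj A)" "\<lambda>\<phi> \<psi>. graph_norm (adj A) (\<phi> - \<psi>)"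
        by (rule Metric_space_graph_norm[OF linear_operator_adj[OF dense]])
      show ?thesis
        unfolding closed_rot_graph_iff[OF lin dense order_refl] graph_topology_def
        using closedin_topspace[of mtopology] by simp
    qed
    moreover have "closed (Map.graph B)"
      using B by (simp add: closed_extensions_def closed_operator_def)
    ultimately have "closed (rot_graph A ?M)"
      by (simp add: closed_Int)
    then show ?thesis
      using closed_rot_graph_iff[OF lin dense sub] by blast
  qed
  moreover have "\<phi> = 0" if \<phi>: "\<phi> \<in> ?M" "app (adj A) \<phi> \<in> dom A" for \<phi>
  proof -
    obtain \<psi> where "adj A \<phi> = Some \<psi>" "B \<psi> = Some (- \<phi>)"
      using \<phi>(1) by (auto simp: ext_space_def)
    moreover from this obtain g where "A \<psi> = Some g"
      using \<phi>(2) by auto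
    ultimately show ?thesis
      using extB[of \<psi> g] adj_eq_uminus by simp
  qed
  moreover have "0 \<in> dom A"
    using linA(1) by blast
  ultimately show ?thesis
    unfolding admissible_iff[OF dense] using sub by blast
qed

text \<open>Each pair in the graph of \<open>B\<close> splits into its projection onto the graph of
  \<open>A\<close> and an orthogonal remainder, which is a rotated pair and stays in the graph of
  \<open>B\<close> by linearity.\<close>

lemma ext_op_ext_space: "ext_op A (ext_space A B) = B"
proof -
  have "ext_op A (ext_space A B) h = Some g \<longleftrightarrow> B h = Some g" for h g
    unfolding ext_op_eq_Some_iff[OF admissible_ext_space]
  proof
    assume "\<exists>f a \<phi> \<psi>. A f = Some a \<and> \<phi> \<in> ext_space A B \<and> adj A \<phi> = Some \<psi> \<and> h = f + \<psi> \<and> g = a - \<phi>"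
    then show "B h = Some g"
      using linear_operatorD(2)[OF linB] extB by (fastforce simp: ext_space_def)
  next
    assume hg: "B h = Some g"
    have "closed (Map.graph A)"
      using closed by (simp add: closed_operator_def)
    then obtain p where "p \<in> Map.graph A"
      and orth: "\<And>v. v \<in> Map.graph A \<Longrightarrow> inner ((h, g) - p) v = 0"
      using closed_subspace_orthogonal_projection[OF subspace_graph[OF lin]] by metis
    then obtain f a where p: "p = (f, a)" and fa: "A f = Some a"
      by (auto simp: Map.graph_def)
    have "\<forall>v\<in>Map.graph A. inner (h - f, g - a) v = 0"
      using orth by (auto simp: p simp del: inner_Pair)
    \<comment> \<open>The remainder \<open>(h - f, g - a)\<close> is the rotated pair of
      \<open>a - g\<close>, which is therefore the required element of
      \<open>ext_space A B\<close>.\<close>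
    then have adj: "adj A (a - g) = Some (h - f)"
      by (simp only: orthogonal_graph_iff[OF lin dense] minus_diff_eq)
    have "B (h - f) = Some (g - a)"
      using linear_operatorD(5)[OF linB hg extB[OF fa]] .
    then have "a - g \<in> ext_space A B"
      using adj by (simp add: ext_space_def)
    with fa adj show "\<exists>f a \<phi> \<psi>. A f = Some a \<and> \<phi> \<in> ext_space A B \<and> adj A \<phi> = Some \<psi> \<and> h = f + \<psi> \<and> g = a - \<phi>"
      by (intro exI[of _ f] exI[of _ a] exI[of _ "a - g"] exI[of _ "h - f"]) simp
  qed
  then show ?thesis
    by (intro ext) (metis option.exhaust)
qed

end

end

text \<open>The maps \<open>ext_op A\<close> and \<open>ext_space A\<close> are mutually inverse.
  The equation with \<open>Some\<close> covers every representation of a vector, so it also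
  certifies that the definite description in \<open>ext_op\<close> is meaningful.\<close>

theorem theorem2p13:
  fixes A :: "'h::complex_hilbert_space \<rightharpoonup> 'h"
  assumes "linear_operator A" and "densely_defined A" and "closed_operator A"
  shows "bij_betw (ext_op A) {M. admissible A M} (closed_extensions A) \<and>
    (\<forall>M. admissible A M \<longrightarrow>
       is_direct_sum (dom (ext_op A M)) (dom A) {app (adj A) \<phi> |\<phi>. \<phi> \<in> M} \<and>
       (\<forall>f\<in>dom A. \<forall>\<phi>\<in>M. ext_op A M (f + app (adj A) \<phi>) = Some (app A f - \<phi>)))"
proof (intro conjI allI impI ballI)
  show "bij_betw (ext_op A) {M. admissible A M} (closed_extensions A)"
    by (rule bij_betw_byWitness[where f' = "ext_space A"])
      (auto simp: ext_space_ext_op[OF assms] ext_op_ext_space[OF assms]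
        ext_op_in_closed_extensions[OF assms] admissible_ext_space[OF assms])
next
  fix M assume M: "admissible A M"
  show "is_direct_sum (dom (ext_op A M)) (dom A) {app (adj A) \<phi> |\<phi>. \<phi> \<in> M}"
    using is_direct_sum_ext_op[OF assms M] .
  fix f \<phi> assume "f \<in> dom A" "\<phi> \<in> M"
  then show "ext_op A M (f + app (adj A) \<phi>) = Some (app A f - \<phi>)"
    using admD(2)[OF assms M] by (intro ext_op_eq[OF assms M]) auto
qed

end
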